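(* For every positive integer $n$, \[ M(3, n) = \begin{cases} 5 & \text{if } n = 3, \\ \lfloor n/3\rfloor & \text{if } n\equiv 0\pmod 3,\ n\neq 3,\\ \lfloor n/3\rfloor + 3 & \text{if } n\equiv 1\pmod 3,\\ \lfloor n/3\rfloor + 2 & \text{if } n\equiv 2\pmod 3. \end{cases} \]
   Context: The $T$-tetromino is the polyomino formed by four unit squares: three in a row together with a fourth square attached to the middle square of that row. A tiling of an $m\times n$ rectangle (of unit cells) by $T$-tetrominos and monominos is a partition of its cells into copies of the $T$-tetromino (in any rotation or reflection, aligned with the grid) and single cells (monominos). The gap number $M(m,n)$ is the least number of monominos occurring in such a tiling of the $m\times n$ rectangle. *)

theory Defs
  imports Complex_Main "HOL-Library.Disjoint_Sets"
begin

text \<open>A unit cell of the grid is identified with its integer (row, column) coordinates.\<close>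

type_synonym cell = "int \<times> int"

definition T_shape :: "cell set" where
  "T_shape = {(0,0), (0,1), (0,2), (1,1)}"

text \<open>All images of the T-tetromino under the symmetry group of the grid, which is generated by
  the quarter turn, one reflection and the translations.\<close>

inductive_set T_tetrominoes :: "cell set set" where
  shape: "T_shape \<in> T_tetrominoes"
| rotate: "X \<in> T_tetrominoes \<Longrightarrow> (\<lambda>(x, y). (- y, x)) ` X \<in> T_tetrominoes"
| reflect: "X \<in> T_tetrominoes \<Longrightarrow> (\<lambda>(x, y). (- x, y)) ` X \<in> T_tetrominoes"
| translate: "X \<in> T_tetrominoes \<Longrightarrow> (\<lambda>(x, y). (x + a, y + b)) ` X \<in> T_tetrominoes"

definition monominoes :: "cell set set" where
  "monominoes = {{c} | c. True}"

definition rectangle :: "nat \<Rightarrow> nat \<Rightarrow> cell set" where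
  "rectangle m n = {0..<int m} \<times> {0..<int n}"

definition is_tiling :: "nat \<Rightarrow> nat \<Rightarrow> cell set set \<Rightarrow> bool" where
  "is_tiling m n P \<longleftrightarrow> partition_on (rectangle m n) P \<and> P \<subseteq> T_tetrominoes \<union> monominoes"

definition gap_number :: "nat \<Rightarrow> nat \<Rightarrow> nat" where
  "gap_number m n = (LEAST k. \<exists>P. is_tiling m n P \<and> card (P \<inter> monominoes) = k)"

text \<open>The minimum in \<^const>\<open>gap_number\<close> is over a nonempty set, and the two kinds of
  tiles are distinct.\<close>

lemma ex_tiling: "\<exists>P. is_tiling m n P"
proof -
  have "is_tiling m n ((\<lambda>c. {c}) ` rectangle m n)"
    by (auto simp: is_tiling_def partition_on_def disjoint_def monominoes_def)
  then show ?thesis by blast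
qed

lemma card_T_tetromino: "X \<in> T_tetrominoes \<Longrightarrow> card X = 4"
proof (induction rule: T_tetrominoes.induct)
  case shape
  show ?case by (simp add: T_shape_def)
qed (subst card_image; auto simp: inj_on_def)+

lemma T_tetromino_not_monomino: "T_tetrominoes \<inter> monominoes = {}"
  using card_T_tetromino by (force simp: monominoes_def)

end

theory Submission
  imports Defs
begin

text \<open>A T-tetromino in a strip of three rows covers the middle cell of its centre column (the
  column of its cell with three neighbours), so the pieces of a packing are determined by their
  centre columns. Three consecutive columns cannot all be centre columns, and this remains true if
  the columns \<open>- 1\<close> and \<open>n\<close> just outside the rectangle are counted as centre columns too. Hence
  at most \<open>\<lfloor>2 * n / 3\<rfloor>\<close> pieces fit. For \<open>n \<noteq> 3\<close> this bound is attained by a chain of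
  interlocking pieces; for \<open>n = 3\<close> only one piece fits.\<close>

section \<open>The four orientations of the T-tetromino in coordinates\<close>

definition T_down :: "int \<Rightarrow> int \<Rightarrow> cell set" where
  "T_down x y = {(x, y - 1), (x, y), (x, y + 1), (x + 1, y)}"

definition T_up :: "int \<Rightarrow> int \<Rightarrow> cell set" where
  "T_up x y = {(x, y - 1), (x, y), (x, y + 1), (x - 1, y)}"

definition T_right :: "int \<Rightarrow> int \<Rightarrow> cell set" where
  "T_right x y = {(x - 1, y), (x, y), (x + 1, y), (x, y + 1)}"

definition T_left :: "int \<Rightarrow> int \<Rightarrow> cell set" where
  "T_left x y = {(x - 1, y), (x, y), (x + 1, y), (x, y - 1)}"

lemmas T_defs = T_down_def T_up_def T_right_def T_left_def

text \<open>Each orientation is anchored at the cell with three neighbours, which moves like a point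
  under the generators, and the first coordinate is a row counted downwards. The four families are
  therefore closed under the three generators, so induction on \<open>T_tetrominoes\<close> can
  produce nothing else.\<close>

lemma rotate_T:
  "(\<lambda>(x, y). (- y, x)) ` T_down x y = T_right (- y) x"
  "(\<lambda>(x, y). (- y, x)) ` T_right x y = T_up (- y) x"
  "(\<lambda>(x, y). (- y, x)) ` T_up x y = T_left (- y) x"
  "(\<lambda>(x, y). (- y, x)) ` T_left x y = T_down (- y) x"
  by (auto simp: T_defs)

lemma reflect_T:
  "(\<lambda>(x, y). (- x, y)) ` T_down x y = T_up (- x) y"
  "(\<lambda>(x, y). (- x, y)) ` T_right x y = T_right (- x) y"
  "(\<lambda>(x, y). (- x, y)) ` T_up x y = T_down (- x) y"
  "(\<lambda>(x, y). (- x, y)) ` T_left x y = T_left (- x) y"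
  by (auto simp: T_defs)

lemma translate_T:
  "(\<lambda>(x, y). (x + a, y + b)) ` T_down x y = T_down (x + a) (y + b)"
  "(\<lambda>(x, y). (x + a, y + b)) ` T_right x y = T_right (x + a) (y + b)"
  "(\<lambda>(x, y). (x + a, y + b)) ` T_up x y = T_up (x + a) (y + b)"
  "(\<lambda>(x, y). (x + a, y + b)) ` T_left x y = T_left (x + a) (y + b)"
  by (auto simp: T_defs)

lemma T_tetromino_cases:
  assumes "X \<in> T_tetrominoes"
  obtains x y where "X = T_down x y" | x y where "X = T_up x y"
    | x y where "X = T_right x y" | x y where "X = T_left x y"
proof -
  have "\<exists>x y. X = T_down x y \<or> X = T_up x y \<or> X = T_right x y \<or> X = T_left x y"
    using assms
  proof (induction rule: T_tetrominoes.induct)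
    case shape
    have "T_shape = T_down 0 1"
      by (simp add: T_shape_def T_down_def)
    then show ?case by blast
  next
    case (rotate X)
    then show ?case by (metis rotate_T)
  next
    case (reflect X)
    then show ?case by (metis reflect_T)
  next
    case (translate X a b)
    then show ?case by (metis translate_T)
  qed
  then show thesis using that by blast
qed

lemma T_tetrominoesI [simp]:
  "T_down x y \<in> T_tetrominoes" "T_up x y \<in> T_tetrominoes"
  "T_right x y \<in> T_tetrominoes" "T_left x y \<in> T_tetrominoes"
proof -
  have "T_shape = T_down 0 1"
    by (simp add: T_shape_def T_down_def)
  then have down: "T_down x y \<in> T_tetrominoes" for x y
    using T_tetrominoes.translate[OF T_tetrominoes.shape, of x "y - 1"]
      translate_T(1)[of x "y - 1" 0 1] by simp
  \<comment> \<open>The quarter turn takes the anchor (y, -x) to (x, y); three successive turns lead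
    from down to right, up and left.\<close>
  have right: "T_right x y \<in> T_tetrominoes" for x y
    using T_tetrominoes.rotate[OF down, of y "- x"] by (simp add: rotate_T)
  have up: "T_up x y \<in> T_tetrominoes" for x y
    using T_tetrominoes.rotate[OF right, of y "- x"] by (simp add: rotate_T)
  have left: "T_left x y \<in> T_tetrominoes" for x y
    using T_tetrominoes.rotate[OF up, of y "- x"] by (simp add: rotate_T)
  show "T_down x y \<in> T_tetrominoes" "T_up x y \<in> T_tetrominoes"
    "T_right x y \<in> T_tetrominoes" "T_left x y \<in> T_tetrominoes"
    by (fact down up right left)+
qed

section \<open>From tilings to packings\<close>

text \<open>Monominoes can fill any cells left over, so minimising them amounts to maximising the
  number of disjoint T-tetrominoes.\<close>

definition T_packing :: "nat \<Rightarrow> nat \<Rightarrow> cell set set \<Rightarrow> bool" where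
  "T_packing m n F \<longleftrightarrow> F \<subseteq> T_tetrominoes \<and> disjoint F \<and> \<Union>F \<subseteq> rectangle m n"

lemma finite_rectangle [simp]: "finite (rectangle m n)"
  by (simp add: rectangle_def)

lemma card_rectangle [simp]: "card (rectangle m n) = m * n"
  by (simp add: rectangle_def card_cartesian_product)

lemma finite_T_packing: "T_packing m n F \<Longrightarrow> finite F"
  by (meson T_packing_def finite_UnionD finite_rectangle finite_subset)

lemma card_Union_T_packing:
  assumes "T_packing m n F"
  shows "card (\<Union>F) = 4 * card F"
proof -
  have "card (\<Union>F) = (\<Sum>X\<in>F. card X)"
    using assms by (intro card_Union_disjoint)
      (auto simp: T_packing_def intro: finite_subset[OF _ finite_rectangle])
  also have "\<dots> = (\<Sum>X\<in>F. 4)"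
    using assms by (intro sum.cong) (auto simp: T_packing_def card_T_tetromino)
  finally show ?thesis by simp
qed

lemma tiling_imp_T_packing:
  assumes "is_tiling m n P"
  shows "T_packing m n (P \<inter> T_tetrominoes)"
    and "card (P \<inter> monominoes) + 4 * card (P \<inter> T_tetrominoes) = m * n"
proof -
  let ?F = "P \<inter> T_tetrominoes" and ?G = "P \<inter> monominoes"
  have part: "partition_on (rectangle m n) P" and P: "P = ?F \<union> ?G"
    using assms by (auto simp: is_tiling_def)
  have U: "\<Union>P = rectangle m n" and dj: "disjoint P"
    using part by (auto simp: partition_on_def)
  show pack: "T_packing m n ?F"
    using U dj by (auto simp: T_packing_def disjoint_def)
  have fin: "finite P"
    using finite_UnionD[of P] U by simp
  have "m * n = (\<Sum>X\<in>P. card X)"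
    using card_Union_disjoint[OF dj] U finite_subset[OF _ finite_rectangle]
    by (metis Union_upper card_rectangle)
  also have "\<dots> = (\<Sum>X\<in>?F \<union> ?G. card X)"
    using P by simp
  also have "\<dots> = (\<Sum>X\<in>?F. card X) + (\<Sum>X\<in>?G. card X)"
    using fin T_tetromino_not_monomino by (intro sum.union_disjoint) auto
  also have "(\<Sum>X\<in>?F. card X) = (\<Sum>X\<in>?F. 4)"
    by (intro sum.cong) (auto simp: card_T_tetromino)
  also have "(\<Sum>X\<in>?G. card X) = (\<Sum>X\<in>?G. 1)"
    by (intro sum.cong) (auto simp: monominoes_def)
  finally show "card ?G + 4 * card ?F = m * n" by simp
qed

lemma T_packing_imp_tiling:
  assumes "T_packing m n F"
  shows "\<exists>P. is_tiling m n P \<and> card (P \<inter> monominoes) = m * n - 4 * card F"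
proof -
  let ?G = "(\<lambda>c. {c}) ` (rectangle m n - \<Union>F)"
  have F: "F \<subseteq> T_tetrominoes" "disjoint F" "\<Union>F \<subseteq> rectangle m n"
    using assms by (auto simp: T_packing_def)
  \<comment> \<open>\<open>partition_on\<close> demands nonempty blocks.\<close>
  have "{} \<notin> T_tetrominoes"
    using card_T_tetromino by fastforce
  then have "is_tiling m n (F \<union> ?G)"
    using F unfolding is_tiling_def partition_on_def
    by (auto simp: disjoint_def monominoes_def)
  moreover have "(F \<union> ?G) \<inter> monominoes = ?G"
    using F T_tetromino_not_monomino by (auto simp: monominoes_def)
  moreover have "card ?G = m * n - 4 * card F"
    using F card_Union_T_packing[OF assms]
    by (simp add: card_image card_Diff_subset finite_subset[OF _ finite_rectangle])
  ultimately show ?thesis by metis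
qed

lemma gap_number_eq:
  assumes "T_packing m n F" "card F = t"
    and "\<And>F. T_packing m n F \<Longrightarrow> card F \<le> t"
  shows "gap_number m n = m * n - 4 * t"
  unfolding gap_number_def
proof (rule Least_equality)
  show "\<exists>P. is_tiling m n P \<and> card (P \<inter> monominoes) = m * n - 4 * t"
    using T_packing_imp_tiling assms(1,2) by blast
next
  fix k
  assume "\<exists>P. is_tiling m n P \<and> card (P \<inter> monominoes) = k"
  then obtain P where P: "is_tiling m n P" "card (P \<inter> monominoes) = k"
    by blast
  show "m * n - 4 * t \<le> k"
    using tiling_imp_T_packing[OF P(1)] assms(3) P(2) by fastforce
qed

section \<open>Integer sets without three consecutive elements\<close>

text \<open>Cutting off the last three integers of the interval removes at most two elements of
  \<open>S\<close>. The additive 2 comes from the base case \<open>N = 2\<close>, where both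
  integers may be present.\<close>

lemma card_no_three_consecutive:
  fixes S :: "int set"
  assumes "S \<subseteq> {a..<a + int N}"
    and "\<And>c. \<not> (c \<in> S \<and> c + 1 \<in> S \<and> c + 2 \<in> S)"
  shows "3 * card S \<le> 2 * N + 2"
  using assms
proof (induction N arbitrary: S rule: less_induct)
  case (less N)
  show ?case
  proof (cases "N < 3")
    case True
    have "card S \<le> N"
      using card_mono[OF _ less.prems(1)] by simp
    with True show ?thesis by linarith
  next
    case False
    define d where "d = a + int (N - 3)"
    have d: "d + 3 = a + int N"
      using False by (simp add: d_def)
    have "3 * card (S \<inter> {a..<d}) \<le> 2 * (N - 3) + 2"
      using False less.prems(2) by (intro less.IH) (auto simp: d_def)
    moreover have "S \<inter> {d..<d + 3} \<subset> {d, d + 1, d + 2}"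
      using less.prems(2)[of d] by auto
    then have "card (S \<inter> {d..<d + 3}) < card {d, d + 1, d + 2}"
      by (intro psubset_card_mono) auto
    then have "card (S \<inter> {d..<d + 3}) \<le> 2" by simp
    moreover have "S = (S \<inter> {a..<d}) \<union> (S \<inter> {d..<d + 3})"
      using less.prems(1) d by auto
    then have "card S \<le> card (S \<inter> {a..<d}) + card (S \<inter> {d..<d + 3})"
      by (metis card_Un_le)
    ultimately show ?thesis using False by linarith
  qed
qed

section \<open>Pieces in a strip of three rows\<close>

definition horizontal_T :: "int \<Rightarrow> cell set set" where
  "horizontal_T c = {T_down 0 c, T_up 1 c, T_down 1 c, T_up 2 c}"

text \<open>Only the rows are confined to 0, 1, 2; the columns may stick out of the rectangle. The
  two ends are treated separately in \<open>centred_T_first_column\<close> and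
  \<open>centred_T_last_column\<close>.\<close>

definition centred_T :: "int \<Rightarrow> cell set set" where
  "centred_T c = {T_right 1 c, T_left 1 c} \<union> horizontal_T c"

lemma centred_T_middle: "X \<in> centred_T c \<Longrightarrow> (1, c) \<in> X"
  by (auto simp: centred_T_def horizontal_T_def T_defs)

lemma T_in_strip_centred:
  assumes "X \<in> T_tetrominoes" "X \<subseteq> rectangle 3 n"
  obtains c where "X \<in> centred_T c"
  using assms(1)
proof (cases rule: T_tetromino_cases)
  case (1 x y)
  then have "x \<in> {0, 1}"
    using assms(2) by (auto simp: T_defs rectangle_def)
  then show thesis
    using 1 that[of y] by (auto simp: centred_T_def horizontal_T_def)
next
  case (2 x y)
  then have "x \<in> {1, 2}"
    using assms(2) by (auto simp: T_defs rectangle_def)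
  then show thesis
    using 2 that[of y] by (auto simp: centred_T_def horizontal_T_def)
next
  case (3 x y)
  then have "x = 1"
    using assms(2) by (auto simp: T_defs rectangle_def)
  then show thesis
    using 3 that[of y] by (auto simp: centred_T_def)
next
  case (4 x y)
  then have "x = 1"
    using assms(2) by (auto simp: T_defs rectangle_def)
  then show thesis
    using 4 that[of y] by (auto simp: centred_T_def)
qed

text \<open>A vertical piece fills its whole centre column, while the bar of a horizontal one
  reaches into both neighbouring columns, so the two kinds cannot be adjacent. Two adjacent vertical
  pieces must point their stems away from each other.\<close>

lemma centred_T_adjacent:
  assumes "X \<in> centred_T c" "Y \<in> centred_T (c + 1)" "X \<inter> Y = {}"
  shows "X \<in> horizontal_T c \<and> Y \<in> horizontal_T (c + 1)
    \<or> X = T_left 1 c \<and> Y = T_right 1 (c + 1)"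
  using assms unfolding centred_T_def horizontal_T_def
  by (elim UnE insertE emptyE; simp add: T_defs)

lemma T_left_neq_right: "T_left x y \<noteq> T_right x' y'"
proof
  assume "T_left x y = T_right x' y'"
  then have "(x - 1, y) \<in> T_right x' y'" "(x + 1, y) \<in> T_right x' y'"
    "(x, y - 1) \<in> T_right x' y'"
    by (auto simp: T_left_def)
  then show False by (auto simp: T_right_def)
qed

text \<open>Column \<open>c + 1\<close> would have to hold a bar cell of \<open>X\<close>, a bar
  cell of \<open>Z\<close>, and both a bar cell and the stem of \<open>Y\<close>: four cells in
  three rows.\<close>

lemma horizontal_T_three:
  assumes "X \<in> horizontal_T c" "Y \<in> horizontal_T (c + 1)" "Z \<in> horizontal_T (c + 2)"
    and "X \<inter> Y = {}" "Y \<inter> Z = {}" "X \<inter> Z = {}"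
  shows False
  using assms unfolding horizontal_T_def
  by (elim insertE emptyE; simp add: T_defs)

text \<open>A horizontal bar has two cells of one row at distance two, but a vertical piece spans
  only two columns.\<close>

lemma horizontal_T_not_vertical:
  assumes "X \<in> horizontal_T c"
  shows "X \<noteq> T_left 1 d" "X \<noteq> T_right 1 d"
proof -
  have "\<exists>x y. {(x, y - 1), (x, y + 1)} \<subseteq> X"
    using assms by (auto simp: horizontal_T_def T_defs)
  moreover have "\<not> {(x, y - 1), (x, y + 1)} \<subseteq> T_left 1 d"
     "\<not> {(x, y - 1), (x, y + 1)} \<subseteq> T_right 1 d" for x y
    by (auto simp: T_defs)
  ultimately show "X \<noteq> T_left 1 d" "X \<noteq> T_right 1 d" by metis+
qed

text \<open>The middle piece is constrained from both sides. If it were vertical, its stem would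
  have to point right because of \<open>X\<close> and left because of \<open>Z\<close>; hence all
  three are horizontal.\<close>

lemma centred_T_three:
  assumes "X \<in> centred_T c" "Y \<in> centred_T (c + 1)" "Z \<in> centred_T (c + 2)"
    and "X \<inter> Y = {}" "Y \<inter> Z = {}" "X \<inter> Z = {}"
  shows False
proof -
  have YZ: "Y \<in> horizontal_T (c + 1) \<and> Z \<in> horizontal_T (c + 2) \<or> Y = T_left 1 (c + 1)"
    using centred_T_adjacent[of Y "c + 1" Z] assms by (auto simp: add.assoc)
  from centred_T_adjacent[OF assms(1,2,4)] show False
  proof
    assume XY: "X \<in> horizontal_T c \<and> Y \<in> horizontal_T (c + 1)"
    then have "Z \<in> horizontal_T (c + 2)"
      using YZ horizontal_T_not_vertical by blast
    then show False
      using horizontal_T_three XY assms(4-6) by blast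
  next
    assume "X = T_left 1 c \<and> Y = T_right 1 (c + 1)"
    then show False
      using YZ horizontal_T_not_vertical T_left_neq_right by metis
  qed
qed

text \<open>Every other piece centred in column 0 reaches column -1; the remaining one has its stem
  in column 1.\<close>

lemma centred_T_first_column:
  assumes "X \<in> centred_T 0" "X \<subseteq> rectangle 3 n"
  shows "X = T_right 1 0" "n > 1"
proof -
  have "\<exists>p\<in>Y. snd p = - 1" if "Y = T_left 1 0 \<or> Y \<in> horizontal_T 0" for Y
    using that by (auto simp: horizontal_T_def T_defs)
  moreover have "\<not> (\<exists>p\<in>X. snd p = - 1)"
    using assms(2) by (auto simp: rectangle_def)
  ultimately show X: "X = T_right 1 0"
    using assms(1) unfolding centred_T_def by blast
  have "(1, 1) \<in> X"
    by (simp add: X T_right_def)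
  then show "n > 1"
    using assms(2) by (auto simp: rectangle_def)
qed

lemma centred_T_last_column:
  assumes "X \<in> centred_T (int n - 1)" "X \<subseteq> rectangle 3 n"
  shows "X = T_left 1 (int n - 1)"
proof -
  have "\<exists>p\<in>Y. snd p = int n" if "Y = T_right 1 (int n - 1) \<or> Y \<in> horizontal_T (int n - 1)" for Y
    using that by (auto simp: horizontal_T_def T_defs)
  moreover have "\<not> (\<exists>p\<in>X. snd p = int n)"
    using assms(2) by (auto simp: rectangle_def)
  ultimately show ?thesis
    using assms(1) unfolding centred_T_def by blast
qed

section \<open>Centre columns of a packing\<close>

definition centres :: "cell set set \<Rightarrow> int set" where
  "centres F = {c. \<exists>X\<in>F. X \<in> centred_T c}"

lemma
  assumes "T_packing 3 n F"
  shows centres_subset: "centres F \<subseteq> {0..<int n}"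
    and card_le_card_centres: "card F \<le> card (centres F)"
proof -
  have F: "F \<subseteq> T_tetrominoes" "disjoint F" "\<And>X. X \<in> F \<Longrightarrow> X \<subseteq> rectangle 3 n"
    using assms by (auto simp: T_packing_def)
  show sub: "centres F \<subseteq> {0..<int n}"
    using F(3) centred_T_middle by (fastforce simp: centres_def rectangle_def)
  have "\<exists>c. X \<in> centred_T c" if "X \<in> F" for X
    using that F T_in_strip_centred by (metis subsetD)
  \<comment> \<open>Pieces with the same centre column \<open>c\<close> share the cell (1, c), so
    any choice of centre columns is injective on \<open>F\<close>.\<close>
  then obtain g where g: "\<And>X. X \<in> F \<Longrightarrow> X \<in> centred_T (g X)"
    by metis
  have "inj_on g F"
  proof (rule inj_onI)
    fix X Y assume "X \<in> F" "Y \<in> F" "g X = g Y"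
    then have "(1, g X) \<in> X \<inter> Y"
      using g centred_T_middle by (metis IntI)
    then show "X = Y"
      using F(2) \<open>X \<in> F\<close> \<open>Y \<in> F\<close> by (auto simp: disjoint_def)
  qed
  moreover have "g ` F \<subseteq> centres F"
    using g by (auto simp: centres_def)
  ultimately show "card F \<le> card (centres F)"
    using sub by (meson card_inj_on_le finite_atLeastLessThan_int finite_subset)
qed

lemma T_packing_disjoint:
  assumes "T_packing m n F" "X \<in> F" "Y \<in> F" "X \<noteq> Y"
  shows "X \<inter> Y = {}"
  using assms by (auto simp: T_packing_def disjoint_def)

text \<open>The columns of the four cells of a T-tetromino with centre column \<open>c\<close> add up to
  \<open>4 * c - 1\<close>, \<open>4 * c\<close> or \<open>4 * c + 1\<close>.\<close>

lemma centred_T_inject: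
  assumes "X \<in> centred_T c" "X \<in> centred_T d"
  shows "c = d"
proof -
  have "\<bar>(\<Sum>p\<in>X. snd p) - 4 * e\<bar> \<le> 1" if "X \<in> centred_T e" for e
    using that unfolding centred_T_def horizontal_T_def
    by (elim UnE insertE emptyE) (simp_all add: T_defs)
  from this[OF assms(1)] this[OF assms(2)] show ?thesis by linarith
qed

lemma centres_no_three:
  assumes F: "T_packing 3 n F"
  shows "\<not> (c \<in> centres F \<and> c + 1 \<in> centres F \<and> c + 2 \<in> centres F)"
proof
  assume "c \<in> centres F \<and> c + 1 \<in> centres F \<and> c + 2 \<in> centres F"
  then obtain X Y Z where X: "X \<in> F" "X \<in> centred_T c" and Y: "Y \<in> F" "Y \<in> centred_T (c + 1)"
    and Z: "Z \<in> F" "Z \<in> centred_T (c + 2)"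
    by (auto simp: centres_def)
  \<comment> \<open>Disjointness of \<open>F\<close> applies only to distinct members; they are
    distinct because a piece has just one centre column.\<close>
  have "X \<noteq> Y" "Y \<noteq> Z" "X \<noteq> Z"
    using X Y Z centred_T_inject[of X c "c + 1"] centred_T_inject[of Y "c + 1" "c + 2"]
      centred_T_inject[of X c "c + 2"] by auto
  then show False
    using centred_T_three[OF X(2) Y(2) Z(2)] T_packing_disjoint[OF F] X Y Z by blast
qed

text \<open>The stem of the piece at the left end takes (1, 1), which any piece centred in column 1
  would need. Together with \<open>n > 1\<close>, which keeps column 1 apart from column
  \<open>n\<close>, this excludes the triple -1, 0, 1 once the outside columns are counted
  too.\<close>

lemma centres_first_columns:
  assumes F: "T_packing 3 n F" and "0 \<in> centres F"
  shows "1 \<notin> centres F" "n > 1" "T_right 1 0 \<in> F"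
proof -
  obtain X where X: "X \<in> F" "X \<in> centred_T 0"
    using assms(2) by (auto simp: centres_def)
  have "X \<subseteq> rectangle 3 n"
    using F X by (auto simp: T_packing_def)
  from centred_T_first_column[OF X(2) this]
  have R: "X = T_right 1 0" and "n > 1" .
  then show "T_right 1 0 \<in> F" "n > 1" using X by auto
  show "1 \<notin> centres F"
  proof
    assume "1 \<in> centres F"
    then obtain Y where Y: "Y \<in> F" "Y \<in> centred_T 1"
      by (auto simp: centres_def)
    have "X \<noteq> Y" using X Y centred_T_inject[of X 0 1] by auto
    moreover have "(1, 1) \<in> X \<inter> Y"
      using R centred_T_middle[OF Y(2)] by (simp add: T_right_def)
    ultimately show False
      using T_packing_disjoint[OF F X(1) Y(1)] by blast
  qed
qed

lemma centres_last_columns: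
  assumes F: "T_packing 3 n F" and "int n - 1 \<in> centres F"
  shows "int n - 2 \<notin> centres F" "T_left 1 (int n - 1) \<in> F"
proof -
  obtain X where X: "X \<in> F" "X \<in> centred_T (int n - 1)"
    using assms(2) by (auto simp: centres_def)
  have "X \<subseteq> rectangle 3 n"
    using F X by (auto simp: T_packing_def)
  from centred_T_last_column[OF X(2) this]
  have L: "X = T_left 1 (int n - 1)" .
  then show "T_left 1 (int n - 1) \<in> F" using X by auto
  show "int n - 2 \<notin> centres F"
  proof
    assume "int n - 2 \<in> centres F"
    then obtain Y where Y: "Y \<in> F" "Y \<in> centred_T (int n - 2)"
      by (auto simp: centres_def)
    have "X \<noteq> Y"
      using X Y centred_T_inject[of X "int n - 1" "int n - 2"] by auto
    moreover have "(1, int n - 2) \<in> X \<inter> Y"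
      using L centred_T_middle[OF Y(2)] by (simp add: T_left_def)
    ultimately show False
      using T_packing_disjoint[OF F X(1) Y(1)] by blast
  qed
qed

section \<open>Upper bounds\<close>

lemma card_T_packing_strip:
  assumes F: "T_packing 3 n F" and "n > 0"
  shows "card F \<le> 2 * n div 3"
proof -
  define S where "S = insert (- 1) (insert (int n) (centres F))"
  have sub: "centres F \<subseteq> {0..<int n}"
    by (rule centres_subset[OF F])
  have "3 * card S \<le> 2 * (n + 2) + 2"
  proof (rule card_no_three_consecutive)
    show "S \<subseteq> {- 1..<- 1 + int (n + 2)}"
      using sub by (auto simp: S_def)
    show "\<not> (c \<in> S \<and> c + 1 \<in> S \<and> c + 2 \<in> S)" for c
    proof
      assume c: "c \<in> S \<and> c + 1 \<in> S \<and> c + 2 \<in> S"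
      \<comment> \<open>A triple starts at the left outside column, ends at the right one, or lies
        inside. For \<open>n = 1\<close> the triple -1, 0, 1 does both and belongs to the first
        case.\<close>
      then consider "c = - 1" | "c + 2 = int n" "c \<noteq> - 1"
        | "c \<in> centres F \<and> c + 1 \<in> centres F \<and> c + 2 \<in> centres F"
        using sub by (fastforce simp: S_def)
      then show False
      proof cases
        case 1
        then have "0 \<in> centres F" "1 \<in> S"
          using c \<open>n > 0\<close> by (auto simp: S_def)
        then show False
          using centres_first_columns[OF F] by (auto simp: S_def)
      next
        case 2
        then have "c = int n - 2" "c \<in> centres F" "c + 1 \<in> centres F"
          using c \<open>n > 0\<close> sub by (auto simp: S_def)
        then have "int n - 1 \<in> centres F" "int n - 2 \<in> centres F"
          by simp_all
        then show False
          using centres_last_columns[OF F] by blast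
      next
        case 3
        then show False using centres_no_three[OF F] by blast
      qed
    qed
  qed
  moreover have "int n \<notin> centres F" "- 1 \<notin> insert (int n) (centres F)" "finite (centres F)"
    using sub finite_subset[OF sub] by auto
  then have "card S = card (centres F) + 2"
    by (simp add: S_def)
  \<comment> \<open>The two outside columns add 6 to the left-hand side, and 2 * (n + 2) + 2 is 2 *
    n + 6, so the slack cancels exactly.\<close>
  ultimately have "3 * card (centres F) \<le> 2 * n"
    by simp
  then have "3 * card F \<le> 2 * n"
    using card_le_card_centres[OF F] by linarith
  then show ?thesis by linarith
qed

text \<open>The strip bound would still allow two pieces. Column 1 cannot be a centre next to an end
  column, so the centres would be 0 and 2, but then both stems claim the cell (1, 1).\<close>

lemma card_T_packing_three:
  assumes F: "T_packing 3 3 F"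
  shows "card F \<le> 1"
proof (rule ccontr)
  assume "\<not> card F \<le> 1"
  then have two: "card (centres F) \<ge> 2"
    using card_le_card_centres[OF F] by linarith
  have sub: "centres F \<subseteq> {0, 1, 2}"
    using centres_subset[OF F] by auto
  have "\<not> (0 \<in> centres F \<and> 2 \<in> centres F)"
  proof
    assume "0 \<in> centres F \<and> 2 \<in> centres F"
    then have "T_right 1 0 \<in> F" "T_left 1 2 \<in> F"
      using centres_first_columns[OF F] centres_last_columns[OF F] by auto
    moreover have "(1, 1) \<in> T_right 1 0 \<inter> T_left 1 2"
      by (simp add: T_defs)
    ultimately show False
      using T_packing_disjoint[OF F] T_left_neq_right by (metis empty_iff)
  qed
  then have "centres F \<subseteq> {0} \<or> centres F \<subseteq> {1} \<or> centres F \<subseteq> {2}"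
    using sub centres_first_columns(1)[OF F] centres_last_columns(1)[OF F] by auto
  then have "card (centres F) \<le> 1"
    using card_mono[of "{_}" "centres F"] by auto
  with two show False by simp
qed

section \<open>Chains of interlocking pieces\<close>

lemma T_packing_insert:
  assumes F: "T_packing m n F" and X: "X \<in> T_tetrominoes" "X \<subseteq> rectangle m n"
    and dj: "\<And>Y. Y \<in> F \<Longrightarrow> X \<inter> Y = {}"
  shows "T_packing m n (insert X F)" "card (insert X F) = Suc (card F)"
proof -
  have "X \<inter> \<Union>F = {}" using dj by blast
  then show "T_packing m n (insert X F)"
    using F X by (auto simp: T_packing_def disjoint_def)
  have "X \<noteq> {}"
    using card_T_tetromino[OF X(1)] by auto
  then have "X \<notin> F"
    using dj by blast
  then show "card (insert X F) = Suc (card F)"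
    using finite_T_packing[OF F] by simp
qed

text \<open>The sequence \<open>0, 2, 3, 5, 6, 8, 9, \<dots>\<close>.\<close>

definition chain_column :: "nat \<Rightarrow> int" where
  "chain_column j = int ((3 * j + 1) div 2)"

text \<open>A vertical piece closes the left end. The odd bars then fill row 0 from column 1 on, the
  even bars fill row 2 from column 2 on, and the stems interlock in row 1.\<close>

definition chain_T :: "nat \<Rightarrow> cell set" where
  "chain_T j = (if j = 0 then T_right 1 0
     else if odd j then T_down 0 (chain_column j) else T_up 2 (chain_column j))"

lemma chain_T_tetromino: "chain_T j \<in> T_tetrominoes"
  by (simp add: chain_T_def)

text \<open>The last column used is \<open>chain_column j + 1\<close>, reached by the stem for
  \<open>j = 0\<close> and by the bar otherwise.\<close>

lemma chain_T_subset:
  assumes "chain_column j + 2 \<le> int n"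
  shows "chain_T j \<subseteq> rectangle 3 n"
proof -
  have "0 \<le> chain_column j" "j > 0 \<Longrightarrow> chain_column j \<ge> 1"
    unfolding chain_column_def by presburger+
  then show ?thesis
    using assms by (auto simp: chain_T_def T_defs rectangle_def)
qed

text \<open>Horizontal pieces of equal parity share a bar row but have centres at least three
  columns apart; those of opposite parity could meet only in row 1, where their stems lie in
  different columns. The initial piece leaves column 0 only at (1, 1), left of all later
  stems.\<close>

lemma chain_T_disjoint:
  assumes "i < j"
  shows "chain_T j \<inter> chain_T i = {}"
proof -
  let ?c = "chain_column j" and ?d = "chain_column i"
  have "?d + 1 \<le> ?c" "?c \<ge> 2" "odd i = odd j \<Longrightarrow> ?d + 3 \<le> ?c"
    "odd j \<Longrightarrow> i > 0 \<Longrightarrow> ?d + 2 \<le> ?c" "i = 0 \<Longrightarrow> ?d = 0"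
    using assms unfolding chain_column_def by presburger+
  then show ?thesis
    using assms by (auto simp: chain_T_def T_defs split: if_splits)
qed

lemma T_packing_chain:
  assumes "chain_column j + 2 \<le> int n"
  shows "T_packing 3 n (chain_T ` {..j}) \<and> card (chain_T ` {..j}) = j + 1"
  using assms
proof (induction j)
  case 0
  then show ?case
    using chain_T_tetromino[of 0] chain_T_subset[of 0 n] by (simp add: T_packing_def)
next
  case (Suc j)
  have "chain_column j + 2 \<le> int n"
    using Suc.prems unfolding chain_column_def by presburger
  then have IH: "T_packing 3 n (chain_T ` {..j})" "card (chain_T ` {..j}) = j + 1"
    using Suc.IH by blast+
  have "chain_T (Suc j) \<inter> Y = {}" if "Y \<in> chain_T ` {..j}" for Y
    using that chain_T_disjoint[of _ "Suc j"] by (elim imageE) simp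
  from T_packing_insert[OF IH(1) chain_T_tetromino chain_T_subset[OF Suc.prems] this]
  show ?case
    using IH(2) by (simp add: atMost_Suc)
qed

text \<open>The chain ends with centre column \<open>3 * m\<close>. For \<open>m > 0\<close> its
  last piece leaves (1, 3 * m + 1) free, so the stem of a vertical piece closing the right end fits
  there. For \<open>m = 0\<close> the only chain piece has its stem at (1, 1), and
  \<open>n \<ge> 4\<close> keeps the closing stem clear of it.\<close>

lemma T_packing_closed_chain:
  assumes "3 * m + 3 \<le> n" "n \<ge> 4"
  shows "\<exists>F. T_packing 3 n F \<and> card F = 2 * m + 2"
proof -
  let ?F = "chain_T ` {..2 * m}" and ?X = "T_left 1 (int n - 1)"
  have F: "T_packing 3 n ?F" "card ?F = 2 * m + 1"
    using T_packing_chain[of "2 * m" n] assms by (auto simp: chain_column_def)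
  have X: "?X \<subseteq> rectangle 3 n"
    using assms by (auto simp: T_left_def rectangle_def)
  have dj: "?X \<inter> chain_T i = {}" if "i \<le> 2 * m" for i
  proof -
    have "chain_column i + 3 \<le> int n"
      using that assms unfolding chain_column_def by presburger
    then show ?thesis
      using that assms by (auto simp: chain_T_def T_defs split: if_splits)
  qed
  then have "?X \<inter> Y = {}" if "Y \<in> ?F" for Y
    using that by blast
  from T_packing_insert[OF F(1) T_tetrominoesI(4) X this] F(2) show ?thesis
    by (intro exI[of _ "insert ?X ?F"]) simp
qed

section \<open>Matching the bounds and evaluating by residues\<close>

theorem theorem1:
  fixes n :: nat
  assumes "n > 0"
  shows "gap_number 3 n =
    (if n = 3 then 5
     else if n mod 3 = 0 then n div 3
     else if n mod 3 = 1 then n div 3 + 3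
     else n div 3 + 2)"
proof -
  define t where "t = (if n = 3 then 1 else 2 * n div 3)"
  have ub: "card F \<le> t" if "T_packing 3 n F" for F
    using that card_T_packing_three card_T_packing_strip[OF that assms] by (auto simp: t_def)
  have "\<exists>F. T_packing 3 n F \<and> card F = t"
  proof -
    have "n = 1 \<or> n = 3 \<or> n mod 3 = 2 \<or> n \<ge> 4 \<and> n mod 3 \<noteq> 2"
      using assms by presburger
    then consider "n = 1" | "n = 3" | "n mod 3 = 2" | "n \<ge> 4" "n mod 3 \<noteq> 2"
      by blast
    then show ?thesis
    proof cases
      case 1
      then show ?thesis
        by (intro exI[of _ "{}"]) (simp add: T_packing_def t_def)
    next
      case 2
      then show ?thesis
        using T_packing_chain[of 0 n] by (auto simp: t_def chain_column_def)
    next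
      case 3
      \<comment> \<open>Here \<open>n = 3 * m + 2\<close>, and a chain of \<open>2 * m + 1\<close>
        pieces ends exactly in column \<open>n - 1\<close>.\<close>
      define m where "m = n div 3"
      have "chain_column (2 * m) + 2 \<le> int n" "2 * m + 1 = t"
        using 3 unfolding chain_column_def m_def t_def by presburger+
      then show ?thesis
        using T_packing_chain[of "2 * m" n] by metis
    next
      case 4
      \<comment> \<open>With q = n div 3 and remainder 0 or 1 the target is 2 * q. The chain
        supplies 2 * q - 1 pieces and the closing vertical piece is the last one.\<close>
      define m where "m = n div 3 - 1"
      have "3 * m + 3 \<le> n" "2 * m + 2 = t"
        using 4 unfolding m_def t_def by presburger+
      then show ?thesis
        using T_packing_closed_chain[of m n] 4 by metis
    qed
  qed
  then obtain F where "T_packing 3 n F" "card F = t" by blast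
  then have "gap_number 3 n = 3 * n - 4 * t"
    using ub by (rule gap_number_eq)
  also have "\<dots> = (if n = 3 then 5
     else if n mod 3 = 0 then n div 3
     else if n mod 3 = 1 then n div 3 + 3
     else n div 3 + 2)"
  proof (cases "n = 3")
    case False
    have n: "n = 3 * (n div 3) + n mod 3"
      by simp
    have "n mod 3 < 3" by simp
    \<comment> \<open>With q = n div 3, the value \<open>3 * n - 4 * t\<close> is 9 * q - 8 * q,
      then 9 * q + 3 - 8 * q, then 9 * q + 6 - (8 * q + 4).\<close>
    then consider "n mod 3 = 0" | "n mod 3 = 1" | "n mod 3 = 2" by linarith
    then show ?thesis
    proof cases
      case 1
      then have "t = 2 * (n div 3)" using False unfolding t_def by presburger
      then show ?thesis using 1 False n by simp
    next
      case 2
      then have "t = 2 * (n div 3)" using False unfolding t_def by presburger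
      then show ?thesis using 2 False n by simp
    next
      case 3
      then have "t = 2 * (n div 3) + 1" using False unfolding t_def by presburger
      then show ?thesis using 3 False n by simp
    qed
  qed (simp add: t_def)
  finally show ?thesis .
qed

end
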